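(* Let $k\ge 1$, and let $S=\mathbb Z_+^k$ (under addition) or $S=\mathbb S_k$, the free semigroup on $k$ generators. Then $c_0(S)$ is the unique Hopf algebra predual of $\ell^1(S)$; that is, $c_0(S)$ is a Hopf algebra predual of $\ell^1(S)$, and every Hopf algebra predual $E\subseteq\ell^\infty(S)$ of $\ell^1(S)$ equals $c_0(S)$.
   Context: $\mathbb Z_+=\{0,1,2,\dots\}$. For a semigroup $S$ (discrete), $\ell^1(S)$ is the complex convolution Banach algebra with standard unit vectors $(\delta_s)_{s\in S}$ and product determined by $\delta_s\delta_t=\delta_{st}$; its dual is identified with $\ell^\infty(S)$, with bimodule actions $(\delta_s\cdot f)(t)=f(ts)$ and $(f\cdot\delta_s)(t)=f(st)$. A predual of a Banach algebra $A$ is a norm-closed sub-bimodule $E\subseteq A^*$ which is a Banach space predual of $A$, i.e. the canonical map $A\to E^*$, $a\mapsto(\mu\mapsto\mu(a))$, is a linear isomorphism (bijective and bicontinuous, not necessarily isometric). A Hopf algebra predual of $\ell^1(S)$ is a predual $E\subseteq\ell^\infty(S)$ which is also a subalgebra of $\ell^\infty(S)$ for the pointwise product. $c_0(S)\subseteq\ell^\infty(S)$ is the space of functions vanishing at infinity on the discrete set $S$. *)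

theory Defs
  imports "HOL-Analysis.Analysis"
begin

(* Throughout, the discrete semigroup S is a whole type 's with an explicit binary operation m,
   so that additive and multiplicative semigroups are treated alike. *)

section \<open>The spaces\<close>

definition ell1 :: "('s \<Rightarrow> complex) set" where
  "ell1 = {a. (\<lambda>s. cmod (a s)) summable_on UNIV}"

definition norm1 :: "('s \<Rightarrow> complex) \<Rightarrow> real" where
  "norm1 a = (\<Sum>\<^sub>\<infinity>s. cmod (a s))"

definition ell_inf :: "('s \<Rightarrow> complex) set" where
  "ell_inf = {f. bounded (range f)}"

definition norm_inf :: "('s \<Rightarrow> complex) \<Rightarrow> real" where
  "norm_inf f = (SUP s. cmod (f s))"

(* For the discrete topology the compact sets are the finite ones, so vanishing at infinity is
   convergence to 0 along the cofinite filter. *)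
definition c0 :: "('s \<Rightarrow> complex) set" where
  "c0 = {f. (f \<longlongrightarrow> 0) cofinite}"

definition delta :: "'s \<Rightarrow> 's \<Rightarrow> complex" where
  "delta s t = (if t = s then 1 else 0)"

definition conv :: "('s \<Rightarrow> 's \<Rightarrow> 's) \<Rightarrow> ('s \<Rightarrow> complex) \<Rightarrow> ('s \<Rightarrow> complex) \<Rightarrow> 's \<Rightarrow> complex" where
  "conv m a b u = (\<Sum>\<^sub>\<infinity>(s, t) \<in> {(s, t). m s t = u}. a s * b t)"

(* The bilinear pairing that identifies the dual of ell1 with ell_inf. *)
definition pairing :: "('s \<Rightarrow> complex) \<Rightarrow> ('s \<Rightarrow> complex) \<Rightarrow> complex" where
  "pairing a f = (\<Sum>\<^sub>\<infinity>s. a s * f s)"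

section \<open>The dual bimodule\<close>

(* The actions on the dual are <b, a.f> = <b * a, f> and <b, f.a> = <a * b, f>; the function
   representing a functional is its restriction to the unit vectors. *)
definition lact :: "('s \<Rightarrow> 's \<Rightarrow> 's) \<Rightarrow> ('s \<Rightarrow> complex) \<Rightarrow> ('s \<Rightarrow> complex) \<Rightarrow> 's \<Rightarrow> complex" where
  "lact m a f t = pairing (conv m (delta t) a) f"

definition ract :: "('s \<Rightarrow> 's \<Rightarrow> 's) \<Rightarrow> ('s \<Rightarrow> complex) \<Rightarrow> ('s \<Rightarrow> complex) \<Rightarrow> 's \<Rightarrow> complex" where
  "ract m f a t = pairing (conv m a (delta t)) f"

lemma conv_delta: "conv m (delta s) (delta t) = delta (m s t)"
proof
  fix u
  have "conv m (delta s) (delta t) u =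
      (\<Sum>\<^sub>\<infinity>p \<in> (if m s t = u then {(s, t)} else {}). delta s (fst p) * delta t (snd p))"
    unfolding conv_def
    by (rule infsum_cong_neutral) (auto simp: delta_def split: if_splits)
  also have "\<dots> = delta (m s t) u"
    by (auto simp: delta_def)
  finally show "conv m (delta s) (delta t) u = delta (m s t) u" .
qed

lemma pairing_delta: "pairing (delta s) f = f s"
proof -
  have "pairing (delta s) f = (\<Sum>\<^sub>\<infinity>t\<in>{s}. f t)"
    unfolding pairing_def by (rule infsum_cong_neutral) (auto simp: delta_def)
  then show ?thesis by simp
qed

lemma lact_delta: "lact m (delta s) f t = f (m t s)"
  by (simp add: lact_def conv_delta pairing_delta)

lemma ract_delta: "ract m f (delta s) t = f (m s t)"
  by (simp add: ract_def conv_delta pairing_delta)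

section \<open>Preduals\<close>

definition complex_subspace :: "('s \<Rightarrow> complex) set \<Rightarrow> bool" where
  "complex_subspace E \<longleftrightarrow>
     (\<lambda>_. 0) \<in> E \<and>
     (\<forall>f\<in>E. \<forall>g\<in>E. (\<lambda>s. f s + g s) \<in> E) \<and>
     (\<forall>c. \<forall>f\<in>E. (\<lambda>s. c * f s) \<in> E)"

definition norm_closed :: "('s \<Rightarrow> complex) set \<Rightarrow> bool" where
  "norm_closed E \<longleftrightarrow>
     (\<forall>f\<in>ell_inf. (\<forall>\<epsilon>>0. \<exists>g\<in>E. norm_inf (\<lambda>s. f s - g s) < \<epsilon>) \<longrightarrow> f \<in> E)"

definition closed_sub_bimodule ::
    "('s \<Rightarrow> 's \<Rightarrow> 's) \<Rightarrow> ('s \<Rightarrow> complex) set \<Rightarrow> bool" where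
  "closed_sub_bimodule m E \<longleftrightarrow>
     E \<subseteq> ell_inf \<and> complex_subspace E \<and> norm_closed E \<and>
     (\<forall>a\<in>ell1. \<forall>f\<in>E. lact m a f \<in> E \<and> ract m f a \<in> E)"

(* Bounded complex-linear functionals on a subspace E of ell_inf; extensionality makes equality
   of functionals mean equality on E. *)
definition dual_space :: "('s \<Rightarrow> complex) set \<Rightarrow> (('s \<Rightarrow> complex) \<Rightarrow> complex) set" where
  "dual_space E = {\<phi> \<in> extensional E.
     (\<forall>f\<in>E. \<forall>g\<in>E. \<phi> (\<lambda>s. f s + g s) = \<phi> f + \<phi> g) \<and>
     (\<forall>c. \<forall>f\<in>E. \<phi> (\<lambda>s. c * f s) = c * \<phi> f) \<and>
     (\<exists>C. \<forall>f\<in>E. cmod (\<phi> f) \<le> C * norm_inf f)}"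

definition dual_norm :: "('s \<Rightarrow> complex) set \<Rightarrow> (('s \<Rightarrow> complex) \<Rightarrow> complex) \<Rightarrow> real" where
  "dual_norm E \<phi> = (SUP f \<in> {f\<in>E. norm_inf f \<le> 1}. cmod (\<phi> f))"

definition canonical_map ::
    "('s \<Rightarrow> complex) set \<Rightarrow> ('s \<Rightarrow> complex) \<Rightarrow> ('s \<Rightarrow> complex) \<Rightarrow> complex" where
  "canonical_map E a = (\<lambda>f\<in>E. pairing a f)"

(* The canonical map is linear, so bicontinuity is the two-sided norm estimate. *)
definition predual :: "('s \<Rightarrow> 's \<Rightarrow> 's) \<Rightarrow> ('s \<Rightarrow> complex) set \<Rightarrow> bool" where
  "predual m E \<longleftrightarrow>
     closed_sub_bimodule m E \<and>
     bij_betw (canonical_map E) ell1 (dual_space E) \<and>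
     (\<exists>C. \<forall>a\<in>ell1. dual_norm E (canonical_map E a) \<le> C * norm1 a) \<and>
     (\<exists>C. \<forall>a\<in>ell1. norm1 a \<le> C * dual_norm E (canonical_map E a))"

definition hopf_algebra_predual :: "('s \<Rightarrow> 's \<Rightarrow> 's) \<Rightarrow> ('s \<Rightarrow> complex) set \<Rightarrow> bool" where
  "hopf_algebra_predual m E \<longleftrightarrow>
     predual m E \<and> (\<forall>f\<in>E. \<forall>g\<in>E. (\<lambda>s. f s * g s) \<in> E)"

section \<open>Free semigroups\<close>

(* Nonempty words over the alphabet 'k under concatenation; there is no identity element. *)
typedef 'k free_semigroup = "{w :: 'k list. w \<noteq> []}"
  by (rule exI[of _ "[undefined]"]) simp

setup_lifting type_definition_free_semigroup

instantiation free_semigroup :: (type) semigroup_mult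
begin

lift_definition times_free_semigroup ::
    "'a free_semigroup \<Rightarrow> 'a free_semigroup \<Rightarrow> 'a free_semigroup"
  is "(@)" by simp

instance
  by standard (transfer, simp)

end

end

theory Submission
  imports Defs
begin

text \<open>Multiplicative functionals on a Hopf algebra predual E are represented by elements of
  \<open>\<ell>\<^sup>1(S)\<close>, and injectivity of the canonical map forces such an element to be 0 or a point mass.
  If f in E did not vanish at infinity, Tychonoff's theorem would give a filter converging to
  infinity in S along which all members of E converge, with a limit functional that is nonzero
  at f and so is evaluation at some s. Finitely many translates tS cover S up to a finite set
  and miss s, so the filter meets some tS; pulling it back along translation by t and
  extracting a limit again, which is evaluation at some r or 0, gives s = tr or that E vanishes
  at s, both impossible. Hence \<open>E \<subseteq> c\<^sub>0(S)\<close>, and since E is an algebra separating points it contains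
  all point masses.\<close>

section \<open>Bounded and summable functions\<close>

lemma norm_inf_upper: "f \<in> ell_inf \<Longrightarrow> cmod (f s) \<le> norm_inf f"
proof -
  assume "f \<in> ell_inf"
  then have "bdd_above (range (\<lambda>s. cmod (f s)))"
    by (auto simp: ell_inf_def bounded_iff bdd_above_def)
  then show ?thesis
    unfolding norm_inf_def by (intro cSUP_upper) auto
qed

lemma norm_inf_least: "(\<And>s. cmod (f s) \<le> B) \<Longrightarrow> norm_inf f \<le> B"
  unfolding norm_inf_def by (rule cSUP_least) auto

lemma ell_infI: "(\<And>s. cmod (f s) \<le> B) \<Longrightarrow> f \<in> ell_inf"
  by (auto simp: ell_inf_def bounded_iff)

lemma norm_inf_nonneg: "f \<in> ell_inf \<Longrightarrow> 0 \<le> norm_inf f"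
  using norm_inf_upper[of f undefined] norm_ge_zero order_trans by blast

section \<open>Finite partial sums and membership in \<open>ell1\<close>\<close>

lemma ell1_sum_bound:
  assumes "a \<in> ell1" "finite F"
  shows "(\<Sum>s\<in>F. cmod (a s)) \<le> norm1 a"
  using assms finite_sum_le_infsum[of "\<lambda>s. cmod (a s)" UNIV F] by (simp add: ell1_def norm1_def)

lemma norm1_le:
  assumes "a \<in> ell1" "\<And>F. finite F \<Longrightarrow> (\<Sum>s\<in>F. cmod (a s)) \<le> B"
  shows "norm1 a \<le> B"
  unfolding norm1_def by (rule infsum_le_finite_sums) (use assms in \<open>auto simp: ell1_def\<close>)

lemma ell1I:
  assumes "\<And>F. finite F \<Longrightarrow> (\<Sum>s\<in>F. cmod (a s)) \<le> B"
  shows "a \<in> ell1"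
  unfolding ell1_def
  by (auto intro!: nonneg_bdd_above_summable_on bdd_aboveI2[of _ _ B] assms)

lemma ell1_summable:
  assumes "a \<in> ell1" "\<And>s. cmod (f s) \<le> B"
  shows "(\<lambda>s. cmod (a s * f s)) summable_on UNIV"
proof (rule Infinite_Sum.abs_summable_on_comparison_test')
  show "(\<lambda>s. cmod (a s) * B) summable_on UNIV"
    using assms by (intro summable_on_cmult_left) (auto simp: ell1_def)
  show "cmod (a s * f s) \<le> cmod (a s) * B" for s
    by (simp add: norm_mult assms mult_left_mono)
qed

lemma pairing_summable:
  assumes "a \<in> ell1" "f \<in> ell_inf"
  shows "(\<lambda>s. a s * f s) summable_on UNIV"
  by (rule abs_summable_summable, rule ell1_summable[OF assms(1) norm_inf_upper[OF assms(2)]])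

lemma ell1_mult:
  assumes "a \<in> ell1" "f \<in> ell_inf"
  shows "(\<lambda>s. a s * f s) \<in> ell1"
  unfolding ell1_def by (simp, rule ell1_summable[OF assms(1) norm_inf_upper[OF assms(2)]])

lemma ell1_add:
  assumes "a \<in> ell1" "b \<in> ell1"
  shows "(\<lambda>s. a s + b s) \<in> ell1"
proof (rule ell1I)
  fix F :: "'a set" assume F: "finite F"
  have "(\<Sum>s\<in>F. cmod (a s + b s)) \<le> (\<Sum>s\<in>F. cmod (a s)) + (\<Sum>s\<in>F. cmod (b s))"
    unfolding sum.distrib[symmetric] by (intro sum_mono norm_triangle_ineq)
  then show "(\<Sum>s\<in>F. cmod (a s + b s)) \<le> norm1 a + norm1 b"
    using ell1_sum_bound[OF assms(1) F] ell1_sum_bound[OF assms(2) F] by linarith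
qed

lemma ell1_scale:
  assumes "a \<in> ell1"
  shows "(\<lambda>s. c * a s) \<in> ell1"
  using assms unfolding ell1_def by (simp add: norm_mult summable_on_cmult_right)

lemma delta_ell1: "delta s \<in> ell1"
proof (rule ell1I[of _ 1])
  fix F :: "'a set" assume "finite F"
  then show "(\<Sum>t\<in>F. cmod (delta s t)) \<le> 1"
    by (simp add: delta_def if_distrib sum.delta cong: if_cong)
qed

section \<open>Bilinearity and boundedness of the pairing\<close>

lemma pairing_add_right:
  assumes "a \<in> ell1" "f \<in> ell_inf" "g \<in> ell_inf"
  shows "pairing a (\<lambda>s. f s + g s) = pairing a f + pairing a g"
  unfolding pairing_def
  using infsum_add[OF pairing_summable[OF assms(1,2)] pairing_summable[OF assms(1,3)]]
  by (simp add: algebra_simps)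

lemma pairing_scale_right: "pairing a (\<lambda>s. c * f s) = c * pairing a f"
  unfolding pairing_def infsum_cmult_right'[symmetric] by (simp add: algebra_simps)

lemma pairing_add_left:
  assumes "a \<in> ell1" "b \<in> ell1" "f \<in> ell_inf"
  shows "pairing (\<lambda>s. a s + b s) f = pairing a f + pairing b f"
  unfolding pairing_def
  using infsum_add[OF pairing_summable[OF assms(1,3)] pairing_summable[OF assms(2,3)]]
  by (simp add: algebra_simps)

lemma pairing_scale_left: "pairing (\<lambda>s. c * a s) f = c * pairing a f"
  unfolding pairing_def infsum_cmult_right'[symmetric] by (simp add: algebra_simps)

lemma pairing_bound:
  assumes "a \<in> ell1" "\<And>s. cmod (f s) \<le> B"
  shows "cmod (pairing a f) \<le> norm1 a * B"
proof -
  have "cmod (pairing a f) \<le> (\<Sum>\<^sub>\<infinity>s. cmod (a s * f s))"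
    unfolding pairing_def by (rule norm_infsum_bound[OF ell1_summable[OF assms]])
  also have "\<dots> \<le> (\<Sum>\<^sub>\<infinity>s. cmod (a s) * B)"
    using assms by (intro infsum_mono[OF ell1_summable[OF assms]] summable_on_cmult_left)
      (auto simp: ell1_def norm_mult mult_left_mono)
  also have "\<dots> = norm1 a * B"
    unfolding norm1_def by (rule infsum_cmult_left')
  finally show ?thesis .
qed

text \<open>Outside a large finite set \<open>F\<close> the mass of \<open>a\<close> is at most
  \<open>d\<close>. Since \<open>F\<close> is chosen before \<open>f\<close>, one truncation serves
  all functions with a common bound, in particular all translates of one function.\<close>

lemma pairing_finite_approx:
  assumes "a \<in> ell1" "0 < d"
  obtains F where "finite F"
    "\<And>f B. (\<And>s. cmod (f s) \<le> B) \<Longrightarrow> cmod (pairing a f - (\<Sum>s\<in>F. a s * f s)) \<le> d * B"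
proof -
  have sa: "(\<lambda>s. cmod (a s)) summable_on UNIV"
    using assms by (simp add: ell1_def)
  have "\<forall>\<^sub>F F in finite_subsets_at_top UNIV. dist (\<Sum>s\<in>F. cmod (a s)) (norm1 a) < d"
    using infsum_tendsto[OF sa] assms(2) unfolding norm1_def by (rule tendstoD)
  then obtain F where F: "finite F" "dist (\<Sum>s\<in>F. cmod (a s)) (norm1 a) < d"
    unfolding eventually_finite_subsets_at_top by blast
  define b where "b = (\<lambda>s. if s \<in> F then 0 else a s)"
  define c where "c = (\<lambda>s. if s \<in> F then a s else 0)"
  have b: "b \<in> ell1"
    by (rule ell1I[of _ "norm1 a"], rule order_trans[OF sum_mono ell1_sum_bound[OF assms(1)]])
      (auto simp: b_def)
  have c: "c \<in> ell1"
    by (rule ell1I[of _ "norm1 a"], rule order_trans[OF sum_mono ell1_sum_bound[OF assms(1)]])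
      (auto simp: c_def)
  have "norm1 b \<le> d"
  proof (rule norm1_le[OF b])
    fix G :: "'a set" assume G: "finite G"
    \<comment> \<open>The mass of \<open>a\<close> on \<open>G - F\<close> is at most what
      \<open>F\<close> leaves of the total mass, and that is less than \<open>d\<close>.\<close>
    have "(\<Sum>s\<in>G. cmod (b s)) = (\<Sum>s\<in>G-F. cmod (a s))"
      by (rule sum.mono_neutral_cong_right) (use G in \<open>auto simp: b_def\<close>)
    moreover have "(\<Sum>s\<in>G-F. cmod (a s)) + (\<Sum>s\<in>F. cmod (a s)) = (\<Sum>s\<in>G\<union>F. cmod (a s))"
      by (subst sum.union_disjoint[symmetric]) (use G F in auto)
    moreover have "\<dots> \<le> norm1 a"
      using ell1_sum_bound[OF assms(1)] G F by simp
    ultimately show "(\<Sum>s\<in>G. cmod (b s)) \<le> d"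
      using F(2) by (simp add: dist_real_def)
  qed
  show ?thesis
  proof (rule that[OF F(1)])
    fix f :: "'a \<Rightarrow> complex" and B assume fB: "\<And>s. cmod (f s) \<le> B"
    have f: "f \<in> ell_inf" using fB by (rule ell_infI)
    have "0 \<le> B" using fB norm_ge_zero order_trans by blast
    have "pairing c f = (\<Sum>s\<in>F. a s * f s)"
      unfolding pairing_def infsum_finite[OF F(1), symmetric]
      by (rule infsum_cong_neutral) (auto simp: c_def)
    moreover have "a = (\<lambda>s. b s + c s)" by (auto simp: b_def c_def)
    ultimately have "pairing a f - (\<Sum>s\<in>F. a s * f s) = pairing b f"
      using pairing_add_left[OF b c f] by simp
    then show "cmod (pairing a f - (\<Sum>s\<in>F. a s * f s)) \<le> d * B"
      using pairing_bound[OF b, of f B] fB mult_right_mono[OF \<open>norm1 b \<le> d\<close> \<open>0 \<le> B\<close>] by simp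
  qed
qed

section \<open>Functions vanishing at infinity\<close>

lemma c0_iff: "f \<in> c0 \<longleftrightarrow> (\<forall>e>0. finite {s. e \<le> cmod (f s)})"
  by (simp add: c0_def tendsto_iff eventually_cofinite not_less)

lemma c0_subset_ell_inf: "c0 \<subseteq> ell_inf"
proof
  fix f :: "'a \<Rightarrow> complex" assume "f \<in> c0"
  then have fin: "finite {s. 1 \<le> cmod (f s)}" by (simp add: c0_iff)
  have "range f \<subseteq> f ` {s. 1 \<le> cmod (f s)} \<union> cball 0 1"
    by (auto simp: image_iff)
  then show "f \<in> ell_inf"
    unfolding ell_inf_def using fin
    by (metis (mono_tags) bounded_Un bounded_cball bounded_subset finite_imageI finite_imp_bounded mem_Collect_eq)
qed

text \<open>Phrased with a pointwise bound, because \<open>norm_inf\<close> controls values only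
  once the difference is known to be bounded.\<close>

lemma c0_uniform_limit:
  assumes "\<And>e. 0 < e \<Longrightarrow> \<exists>g\<in>c0. \<forall>s. cmod (f s - g s) \<le> e"
  shows "f \<in> c0"
  unfolding c0_iff
proof (intro allI impI)
  fix e :: real assume "0 < e"
  then obtain g where g: "g \<in> c0" "\<And>s. cmod (f s - g s) \<le> e / 2"
    using assms[of "e / 2"] by auto
  have "e / 2 \<le> cmod (g s)" if "e \<le> cmod (f s)" for s
    using norm_triangle_ineq2[of "f s" "g s"] g(2)[of s] that by linarith
  then show "finite {s. e \<le> cmod (f s)}"
    using g(1) \<open>0 < e\<close> finite_subset[of "{s. e \<le> cmod (f s)}" "{s. e / 2 \<le> cmod (g s)}"]
    unfolding c0_iff by (metis (mono_tags) Collect_mono half_gt_zero)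
qed

lemma c0_subspace: "complex_subspace c0"
  unfolding complex_subspace_def c0_def
  by (auto intro: tendsto_eq_intros)

lemma c0_norm_closed: "norm_closed c0"
  unfolding norm_closed_def
proof (intro ballI impI)
  fix f :: "'a \<Rightarrow> complex"
  assume f: "f \<in> ell_inf" and lim: "\<forall>e>0. \<exists>g\<in>c0. norm_inf (\<lambda>s. f s - g s) < e"
  show "f \<in> c0"
  proof (rule c0_uniform_limit)
    fix e :: real assume "0 < e"
    then obtain g where g: "g \<in> c0" "norm_inf (\<lambda>s. f s - g s) < e" using lim by blast
    have "(\<lambda>s. f s - g s) \<in> ell_inf"
      using f g(1) c0_subset_ell_inf unfolding ell_inf_def
      by (auto intro: bounded_minus_comp)
    then show "\<exists>g\<in>c0. \<forall>s. cmod (f s - g s) \<le> e"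
      using g norm_inf_upper by (metis (no_types, lifting) less_eq_real_def order_trans)
  qed
qed

lemma c0_mult: "f \<in> c0 \<Longrightarrow> g \<in> c0 \<Longrightarrow> (\<lambda>s. f s * g s) \<in> c0"
  unfolding c0_def using tendsto_mult_zero by blast

text \<open>Preimages of finite level sets under an injection are finite. Cancellation in the
  semigroup enters \<open>c0\<close> through this fact.\<close>

lemma c0_comp_inj:
  assumes "f \<in> c0" "inj h"
  shows "(\<lambda>s. f (h s)) \<in> c0"
  unfolding c0_iff
proof (intro allI impI)
  fix e :: real assume "0 < e"
  then have "finite (h -` {s. e \<le> cmod (f s)})"
    using assms by (intro finite_vimageI) (auto simp: c0_iff)
  then show "finite {s. e \<le> cmod (f (h s))}" by (simp add: vimage_def)
qed

lemma c0_finite_support: "finite F \<Longrightarrow> (\<lambda>s. if s \<in> F then c s else 0) \<in> c0"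
  unfolding c0_iff by (auto intro: rev_finite_subset)

section \<open>Finite combinations and uniform approximation in \<open>c0\<close>\<close>

lemma subspace_sum:
  assumes "complex_subspace E" "\<And>u. u \<in> F \<Longrightarrow> g u \<in> E"
  shows "(\<lambda>s. \<Sum>u\<in>F. c u * g u s) \<in> E"
  using assms(2)
proof (induction F rule: infinite_finite_induct)
  case (insert u F)
  then have "(\<lambda>s. c u * g u s) \<in> E" "(\<lambda>s. \<Sum>u\<in>F. c u * g u s) \<in> E"
    using assms(1) by (auto simp: complex_subspace_def)
  then show ?case
    using assms(1) insert.hyps by (simp add: complex_subspace_def)
qed (use assms in \<open>auto simp: complex_subspace_def\<close>)

lemma sum_delta_eq:
  "finite F \<Longrightarrow> (\<lambda>s. \<Sum>u\<in>F. c u * delta u s) = (\<lambda>s. if s \<in> F then c s else 0)"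
  by (auto simp: delta_def fun_eq_iff if_distrib sum.delta cong: if_cong)

lemma delta_c0: "delta s \<in> c0"
  using c0_finite_support[of "{s}" "\<lambda>_. 1"] by (simp add: delta_def[abs_def])

text \<open>Truncating \<open>a\<close> to a finite set gives a finite combination of functions
  \<open>f\<close> composed with injections, and the error is uniform in \<open>t\<close>. With
  \<open>h\<close> the product, in either order of its arguments, this covers both module
  actions.\<close>

lemma c0_orbit:
  assumes "f \<in> c0" "a \<in> ell1" "\<And>r. inj (h r)"
  shows "(\<lambda>t. pairing a (\<lambda>r. f (h r t))) \<in> c0"
proof (rule c0_uniform_limit)
  fix e :: real assume "0 < e"
  \<comment> \<open>The summand 1 keeps \<open>B\<close> positive even for \<open>f = 0\<close>, so
    that \<open>e / B\<close> is a valid tolerance.\<close>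
  define B where "B = norm_inf f + 1"
  have f: "f \<in> ell_inf" using assms c0_subset_ell_inf by blast
  have B: "0 < B" "\<And>s. cmod (f s) \<le> B"
    using norm_inf_nonneg[OF f] norm_inf_upper[OF f] unfolding B_def by (auto intro: add_increasing2)
  obtain F where F: "finite F"
    "\<And>g B'. (\<And>s. cmod (g s) \<le> B') \<Longrightarrow> cmod (pairing a g - (\<Sum>s\<in>F. a s * g s)) \<le> e / B * B'"
    using pairing_finite_approx[OF assms(2), of "e / B"] \<open>0 < e\<close> B(1) divide_pos_pos by blast
  have "(\<lambda>t. \<Sum>r\<in>F. a r * f (h r t)) \<in> c0"
    by (rule subspace_sum[OF c0_subspace]) (use assms c0_comp_inj in blast)
  moreover have "cmod (pairing a (\<lambda>r. f (h r t)) - (\<Sum>r\<in>F. a r * f (h r t))) \<le> e" for t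
    using F(2)[of "\<lambda>r. f (h r t)" B] B by simp
  ultimately show "\<exists>g\<in>c0. \<forall>t. cmod (pairing a (\<lambda>r. f (h r t)) - g t) \<le> e"
    by (intro bexI[of _ "\<lambda>t. \<Sum>r\<in>F. a r * f (h r t)"]) auto
qed

text \<open>Cutting \<open>f\<close> off where its modulus is below \<open>e / 2\<close> leaves a
  finite combination of point masses, at uniform distance at most \<open>e / 2\<close>.\<close>

lemma c0_subset:
  assumes "E \<subseteq> ell_inf" "complex_subspace E" "norm_closed E" "\<And>s. delta s \<in> E"
  shows "c0 \<subseteq> E"
proof
  fix f :: "'a \<Rightarrow> complex" assume f: "f \<in> c0"
  have "\<exists>g\<in>E. norm_inf (\<lambda>s. f s - g s) < e" if "0 < e" for e
  proof -
    have fin: "finite {s. e / 2 \<le> cmod (f s)}" (is "finite ?F")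
      using f half_gt_zero[OF that] unfolding c0_iff by blast
    have "(\<lambda>s. \<Sum>u\<in>?F. f u * delta u s) \<in> E"
      by (rule subspace_sum) (use assms in auto)
    then have "(\<lambda>s. if s \<in> ?F then f s else 0) \<in> E"
      unfolding sum_delta_eq[OF fin] .
    moreover have "norm_inf (\<lambda>s. f s - (if s \<in> ?F then f s else 0)) \<le> e / 2"
      by (rule norm_inf_least) (use that in auto)
    ultimately show ?thesis using that by (intro bexI) auto
  qed
  then show "f \<in> E"
    using assms(3) f c0_subset_ell_inf unfolding norm_closed_def by blast
qed

section \<open>The standard predual of a cancellative semigroup\<close>

text \<open>Convolution with \<open>delta t\<close> transports \<open>a\<close> along the injection
  \<open>m t\<close>: it has value \<open>a r\<close> at \<open>m t r\<close> and vanishes off the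
  range.\<close>

lemma pairing_conv_delta_left:
  assumes "inj (m t)"
  shows "pairing (conv m (delta t) a) f = pairing a (\<lambda>r. f (m t r))"
proof -
  have conv: "conv m (delta t) a (m t r) = a r" for r
  proof -
    have "conv m (delta t) a (m t r) = (\<Sum>\<^sub>\<infinity>(s, q)\<in>{(t, r)}. delta t s * a q)"
      unfolding conv_def
      by (rule infsum_cong_neutral) (use assms in \<open>auto simp: delta_def inj_def split: if_splits\<close>)
    then show ?thesis by (simp add: delta_def)
  qed
  have "conv m (delta t) a u = 0" if "u \<notin> range (m t)" for u
    unfolding conv_def by (rule infsum_0) (use that in \<open>auto simp: delta_def\<close>)
  then have "pairing (conv m (delta t) a) f = (\<Sum>\<^sub>\<infinity>u\<in>range (m t). conv m (delta t) a u * f u)"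
    unfolding pairing_def by (intro infsum_cong_neutral) auto
  also have "\<dots> = pairing a (\<lambda>r. f (m t r))"
    unfolding pairing_def by (simp add: infsum_reindex[OF assms] o_def conv)
  finally show ?thesis .
qed

text \<open>Passing to the opposite semigroup reduces right translation to left translation.\<close>

lemma conv_delta_right: "conv m a (delta t) = conv (\<lambda>r s. m s r) (delta t) a"
proof
  fix u
  show "conv m a (delta t) u = conv (\<lambda>r s. m s r) (delta t) a u"
    unfolding conv_def
    by (rule infsum_reindex_bij_witness[of _ prod.swap prod.swap]) auto
qed

lemma pairing_conv_delta_right:
  assumes "inj (\<lambda>s. m s t)"
  shows "pairing (conv m a (delta t)) f = pairing a (\<lambda>r. f (m r t))"
  unfolding conv_delta_right by (rule pairing_conv_delta_left) (rule assms)

section \<open>The duality between \<open>c0\<close> and \<open>ell1\<close>\<close>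

lemma canonical_map_in_dual_space:
  assumes "a \<in> ell1" "E \<subseteq> ell_inf" "complex_subspace E"
  shows "canonical_map E a \<in> dual_space E"
proof -
  have "cmod (pairing a f) \<le> norm1 a * norm_inf f" if "f \<in> E" for f
    by (rule pairing_bound[OF assms(1) norm_inf_upper]) (use that assms(2) in blast)
  moreover have "pairing a (\<lambda>s. f s + g s) = pairing a f + pairing a g" if "f \<in> E" "g \<in> E" for f g
    by (rule pairing_add_right[OF assms(1)]) (use that assms(2) in blast)+
  ultimately show ?thesis
    using assms(3) by (auto simp: dual_space_def canonical_map_def complex_subspace_def pairing_scale_right)
qed

lemma dual_space_sum:
  assumes "\<phi> \<in> dual_space E" "complex_subspace E" "\<And>u. u \<in> F \<Longrightarrow> g u \<in> E"
  shows "\<phi> (\<lambda>s. \<Sum>u\<in>F. c u * g u s) = (\<Sum>u\<in>F. c u * \<phi> (g u))"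
proof -
  have zero: "\<phi> (\<lambda>_. 0) = 0"
  proof -
    have "(\<lambda>_. 0) \<in> E" using assms(2) by (simp add: complex_subspace_def)
    moreover have "\<forall>f\<in>E. \<phi> (\<lambda>s. 0 * f s) = 0 * \<phi> f"
      using assms(1) unfolding dual_space_def by blast
    ultimately show ?thesis by auto
  qed
  show ?thesis
    using assms(3)
  proof (induction F rule: infinite_finite_induct)
    case (insert u F)
    have "(\<lambda>s. c u * g u s) \<in> E" "(\<lambda>s. \<Sum>u\<in>F. c u * g u s) \<in> E"
      using assms(2) insert.prems subspace_sum[OF assms(2), of F g c]
      by (auto simp: complex_subspace_def)
    then have "\<phi> (\<lambda>s. c u * g u s + (\<Sum>u\<in>F. c u * g u s))
        = c u * \<phi> (g u) + \<phi> (\<lambda>s. \<Sum>u\<in>F. c u * g u s)"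
      using assms(1) insert.prems unfolding dual_space_def by auto
    then show ?case using insert by simp
  qed (use zero in auto)
qed

text \<open>Conjugate signs rotate every \<open>a u\<close> onto the nonnegative real axis, so a
  function of finite support and sup norm at most 1 recovers the partial sum of
  \<open>norm1 a\<close> over \<open>F\<close>.\<close>

lemma ell1_finite_norming:
  fixes a :: "'s \<Rightarrow> complex"
  assumes "finite F"
  obtains c where "\<And>u. cmod (if u \<in> F then c u else 0) \<le> 1"
    "(\<Sum>u\<in>F. c u * a u) = of_real (\<Sum>u\<in>F. cmod (a u))"
proof
  show "cmod (if u \<in> F then cnj (sgn (a u)) else 0) \<le> 1" for u
    by (simp add: norm_sgn)
  have "cnj (sgn z) * z = of_real (cmod z)" for z
    by (cases "z = 0")
      (auto simp: sgn_div_norm scaleR_conv_of_real mult.commute[of "cnj z" z]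
        complex_norm_square[symmetric] power2_eq_square divide_simps)
  then show "(\<Sum>u\<in>F. cnj (sgn (a u)) * a u) = of_real (\<Sum>u\<in>F. cmod (a u))"
    by simp
qed

lemma canonical_map_c0_inj: "inj_on (canonical_map c0) ell1"
proof (rule inj_onI)
  fix a b :: "'s \<Rightarrow> complex"
  assume ab: "canonical_map c0 a = canonical_map c0 b"
  have "pairing a (delta s) = a s" for a :: "'s \<Rightarrow> complex" and s
  proof -
    have "pairing a (delta s) = (\<Sum>\<^sub>\<infinity>t\<in>{s}. a t)"
      unfolding pairing_def by (rule infsum_cong_neutral) (auto simp: delta_def)
    then show ?thesis by simp
  qed
  then show "a = b"
    using fun_cong[OF ab, of "delta _"] by (auto simp: canonical_map_def delta_c0 fun_eq_iff)
qed

text \<open>The only candidate for a representing \<open>a\<close> is the list of values of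
  \<open>\<phi>\<close> at point masses. Norming functions bound its partial sums by the norm of
  \<open>\<phi>\<close>; agreement on finite supports then extends to \<open>c0\<close> by
  density.\<close>

lemma canonical_map_c0_surj:
  assumes "\<phi> \<in> dual_space c0"
  shows "\<phi> \<in> canonical_map c0 ` ell1"
proof -
  define a where "a = (\<lambda>s. \<phi> (delta s))"
  obtain C where C: "\<And>f. f \<in> c0 \<Longrightarrow> cmod (\<phi> f) \<le> C * norm_inf f"
    using assms unfolding dual_space_def by blast
  have \<phi>: "\<phi> (\<lambda>s. if s \<in> F then c s else 0) = (\<Sum>u\<in>F. c u * a u)" if "finite F" for F c
    using dual_space_sum[OF assms c0_subspace, of F delta c]
    by (simp add: sum_delta_eq[OF that] a_def delta_c0)
  have a: "a \<in> ell1"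
  proof (rule ell1I)
    fix F :: "'a set" assume F: "finite F"
    obtain c where c: "\<And>u. cmod (if u \<in> F then c u else 0) \<le> 1"
      "(\<Sum>u\<in>F. c u * a u) = of_real (\<Sum>u\<in>F. cmod (a u))"
      using ell1_finite_norming[OF F] by metis
    have "(\<Sum>u\<in>F. cmod (a u)) = cmod (\<phi> (\<lambda>s. if s \<in> F then c s else 0))"
      unfolding \<phi>[OF F] c(2) norm_of_real by (simp add: sum_nonneg)
    also have "\<dots> \<le> C * norm_inf (\<lambda>s. if s \<in> F then c s else 0)"
      using C c0_finite_support[OF F] by blast
    \<comment> \<open>The bound in \<open>dual_space\<close> does not say that \<open>C\<close> is
      nonnegative.\<close>
    also have "\<dots> \<le> \<bar>C\<bar> * norm_inf (\<lambda>s. if s \<in> F then c s else 0)"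
      by (intro mult_right_mono norm_inf_nonneg subsetD[OF c0_subset_ell_inf] c0_finite_support F)
        simp
    also have "\<dots> \<le> \<bar>C\<bar> * 1"
      by (intro mult_left_mono norm_inf_least c(1)) auto
    finally show "(\<Sum>u\<in>F. cmod (a u)) \<le> \<bar>C\<bar>" by simp
  qed
  have eq: "\<phi> f = pairing a f" if f: "f \<in> c0" for f
  proof -
    define D where "D = \<bar>C\<bar> + norm1 a"
    have "0 \<le> D" unfolding D_def using ell1_sum_bound[OF a, of "{}"] by simp
    have le: "cmod (\<phi> f - pairing a f) \<le> D * e" if e: "0 < e" for e
    proof -
      \<comment> \<open>Splitting at level \<open>e\<close>: both functionals agree on the finitely
        supported \<open>g\<close>, and both are small on the remainder \<open>h\<close>, whose
        values are at most \<open>e\<close>.\<close>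
      define F where "F = {s. e \<le> cmod (f s)}"
      have F: "finite F" unfolding F_def using f e by (simp add: c0_iff)
      define g h where "g = (\<lambda>s. if s \<in> F then f s else 0)" and "h = (\<lambda>s. f s - g s)"
      have g: "g \<in> c0" unfolding g_def by (rule c0_finite_support[OF F])
      have h: "h \<in> c0"
        using f g tendsto_diff[of f 0 cofinite g 0] by (simp add: c0_def h_def)
      have he: "cmod (h s) \<le> e" for s
        using e by (auto simp: h_def g_def F_def)
      have f_eq: "f = (\<lambda>s. h s + g s)" by (simp add: h_def)
      have "\<phi> f = \<phi> h + \<phi> g"
        unfolding f_eq using assms h g unfolding dual_space_def by blast
      moreover have "pairing a f = pairing a h + pairing a g"
        unfolding f_eq using pairing_add_right a h g c0_subset_ell_inf by blast
      moreover have "\<phi> g = pairing a g"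
      proof -
        have "pairing a g = (\<Sum>\<^sub>\<infinity>u\<in>F. a u * f u)"
          unfolding pairing_def by (rule infsum_cong_neutral) (auto simp: g_def)
        then show ?thesis
          unfolding g_def \<phi>[OF F] using F by (simp add: mult.commute)
      qed
      ultimately have "cmod (\<phi> f - pairing a f) \<le> cmod (\<phi> h) + cmod (pairing a h)"
        by (simp add: norm_triangle_ineq4)
      also have "cmod (\<phi> h) \<le> \<bar>C\<bar> * norm_inf h"
        by (rule order_trans[OF C[OF h]])
          (intro mult_right_mono norm_inf_nonneg subsetD[OF c0_subset_ell_inf] h, simp)
      also have "\<dots> \<le> \<bar>C\<bar> * e"
        by (intro mult_left_mono norm_inf_least he) auto
      also have "cmod (pairing a h) \<le> norm1 a * e"
        by (rule pairing_bound[OF a he])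
      finally show ?thesis by (simp add: D_def algebra_simps)
    qed
    have "cmod (\<phi> f - pairing a f) \<le> 0 + e" if "0 < e" for e
    proof -
      \<comment> \<open>The denominator \<open>D + 1\<close> covers the case
        \<open>D = 0\<close>.\<close>
      have "cmod (\<phi> f - pairing a f) \<le> D * (e / (D + 1))"
        by (rule le) (use \<open>0 \<le> D\<close> that in simp)
      also have "\<dots> \<le> e"
        using \<open>0 \<le> D\<close> that by (simp add: field_simps)
      finally show ?thesis by simp
    qed
    then have "cmod (\<phi> f - pairing a f) \<le> 0"
      by (rule field_le_epsilon)
    then show ?thesis by simp
  qed
  have "\<phi> = canonical_map c0 a"
    using assms eq by (auto simp: canonical_map_def dual_space_def extensional_def fun_eq_iff)
  then show ?thesis using a by blast
qed

text \<open>A real supremum is meaningful only over a nonempty set bounded above: the zero function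
  supplies the first, the estimate of the pairing by \<open>norm1 a\<close> the second.\<close>

lemma dual_norm_canonical_map_le:
  assumes "a \<in> ell1" "E \<subseteq> ell_inf" "complex_subspace E"
  shows "dual_norm E (canonical_map E a) \<le> norm1 a"
    and "\<And>f. f \<in> E \<Longrightarrow> norm_inf f \<le> 1 \<Longrightarrow> cmod (pairing a f) \<le> dual_norm E (canonical_map E a)"
proof -
  have bound: "cmod (canonical_map E a f) \<le> norm1 a" if "f \<in> {f \<in> E. norm_inf f \<le> 1}" for f
  proof -
    have "cmod (f s) \<le> 1" for s
      using norm_inf_upper[of f s] that assms(2) by force
    then show ?thesis
      using pairing_bound[OF assms(1), of f 1] that by (simp add: canonical_map_def)
  qed
  have "norm_inf (\<lambda>_. 0) \<le> 1" by (rule norm_inf_least) auto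
  then have "(\<lambda>_. 0) \<in> {f \<in> E. norm_inf f \<le> 1}"
    using assms(3) by (simp add: complex_subspace_def)
  then show "dual_norm E (canonical_map E a) \<le> norm1 a"
    unfolding dual_norm_def by (intro cSUP_least bound) auto
  show "cmod (pairing a f) \<le> dual_norm E (canonical_map E a)" if "f \<in> E" "norm_inf f \<le> 1" for f
  proof -
    have "bdd_above ((\<lambda>f. cmod (canonical_map E a f)) ` {f \<in> E. norm_inf f \<le> 1})"
      by (rule bdd_aboveI2) (rule bound)
    from cSUP_upper[OF _ this, of f] show ?thesis
      using that by (simp add: dual_norm_def canonical_map_def)
  qed
qed

text \<open>The finitely supported norming functions lie in the unit ball of \<open>c0\<close>. With
  the opposite estimate, the canonical map for \<open>c0\<close> is isometric.\<close>

lemma norm1_le_dual_norm_c0: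
  assumes "a \<in> ell1"
  shows "norm1 a \<le> dual_norm c0 (canonical_map c0 a)"
proof (rule norm1_le[OF assms])
  fix F :: "'a set" assume F: "finite F"
  obtain c where c: "\<And>u. cmod (if u \<in> F then c u else 0) \<le> 1"
    "(\<Sum>u\<in>F. c u * a u) = of_real (\<Sum>u\<in>F. cmod (a u))"
    using ell1_finite_norming[OF F] by metis
  have "pairing a (\<lambda>s. if s \<in> F then c s else 0) = (\<Sum>\<^sub>\<infinity>u\<in>F. a u * c u)"
    unfolding pairing_def by (rule infsum_cong_neutral) auto
  also have "\<dots> = of_real (\<Sum>u\<in>F. cmod (a u))"
    using c(2) F by (simp add: mult.commute)
  finally have "cmod (pairing a (\<lambda>s. if s \<in> F then c s else 0)) = (\<Sum>u\<in>F. cmod (a u))"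
    by (simp only: norm_of_real) (simp add: sum_nonneg)
  then show "(\<Sum>u\<in>F. cmod (a u)) \<le> dual_norm c0 (canonical_map c0 a)"
    using dual_norm_canonical_map_le(2)[OF assms c0_subset_ell_inf c0_subspace
        c0_finite_support[OF F] norm_inf_least[OF c(1)]] by simp
qed

text \<open>Two-sided cancellation lets both actions preserve \<open>c0\<close>: each is an
  absolutely convergent combination of translates along injections.\<close>

theorem hopf_algebra_predual_c0:
  assumes "\<And>t. inj (m t)" "\<And>t. inj (\<lambda>s. m s t)"
  shows "hopf_algebra_predual m c0"
proof -
  have "lact m a f \<in> c0" "ract m f a \<in> c0" if "a \<in> ell1" "f \<in> c0" for a f
  proof -
    have "lact m a f = (\<lambda>t. pairing a (\<lambda>r. f (m t r)))"
      "ract m f a = (\<lambda>t. pairing a (\<lambda>r. f (m r t)))"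
      by (simp_all add: fun_eq_iff lact_def ract_def pairing_conv_delta_left[OF assms(1)]
          pairing_conv_delta_right[OF assms(2)])
    then show "lact m a f \<in> c0" "ract m f a \<in> c0"
      using c0_orbit[OF that(2,1), of "\<lambda>r t. m t r"] c0_orbit[OF that(2,1), of m] assms
      by simp_all
  qed
  moreover have "canonical_map c0 a \<in> dual_space c0" if "a \<in> ell1" for a :: "'a \<Rightarrow> complex"
    using canonical_map_in_dual_space[OF that c0_subset_ell_inf c0_subspace] .
  then have "bij_betw (canonical_map c0) (ell1 :: ('a \<Rightarrow> complex) set) (dual_space c0)"
    using canonical_map_c0_inj canonical_map_c0_surj by (auto simp: bij_betw_def)
  moreover have "\<exists>C. \<forall>a\<in>ell1. dual_norm c0 (canonical_map c0 a) \<le> C * norm1 (a :: 'a \<Rightarrow> complex)"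
    by (intro exI[of _ 1])
      (auto intro: dual_norm_canonical_map_le(1)[OF _ c0_subset_ell_inf c0_subspace])
  moreover have "\<exists>C. \<forall>a\<in>ell1. norm1 (a :: 'a \<Rightarrow> complex) \<le> C * dual_norm c0 (canonical_map c0 a)"
    by (intro exI[of _ 1]) (auto intro: norm1_le_dual_norm_c0)
  ultimately show ?thesis
    unfolding hopf_algebra_predual_def predual_def closed_sub_bimodule_def
    using c0_subset_ell_inf c0_subspace c0_norm_closed c0_mult by blast
qed

section \<open>Characters of a Hopf algebra predual\<close>

text \<open>Evaluation maps the points of the set into a product of discs, compact by Tychonoff's
  theorem. A cluster point of the image filter yields a single refinement along which all bounded
  functions converge at once.\<close>

lemma limit_along_subfilter:
  fixes F :: "'s filter"
  assumes "F \<noteq> bot"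
  obtains F' \<phi> where "F' \<noteq> bot" "F' \<le> F" "\<And>g. g \<in> ell_inf \<Longrightarrow> (g \<longlongrightarrow> \<phi> g) F'"
proof -
  \<comment> \<open>The index set contains unbounded \<open>g\<close> too, where
    \<open>norm_inf g\<close> is unspecified; the default value 0 lies in the disc because its
    radius is an absolute value.\<close>
  define \<Phi> where "\<Phi> = (\<lambda>s (g :: 's \<Rightarrow> complex). if g \<in> ell_inf then g s else 0)"
  define K where "K = PiE UNIV (\<lambda>g :: 's \<Rightarrow> complex. cball (0 :: complex) \<bar>norm_inf g\<bar>)"
  have "compactin (product_topology (\<lambda>_. euclidean) UNIV) K"
    unfolding K_def compactin_PiE by simp
  then have "compact K"
    by (simp add: euclidean_product_topology)
  moreover have "\<Phi> s \<in> K" for s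
    by (auto simp: K_def \<Phi>_def intro: order_trans[OF norm_inf_upper abs_ge_self])
  then have "eventually (\<lambda>h. h \<in> K) (filtermap \<Phi> F)"
    by (simp add: eventually_filtermap)
  ultimately obtain \<phi> where \<phi>: "inf (nhds \<phi>) (filtermap \<Phi> F) \<noteq> bot"
    unfolding compact_filter using assms by (metis filtermap_bot_iff)
  \<comment> \<open>Refining by the preimages of neighbourhoods of \<open>\<phi>\<close> turns the
    cluster point into a limit.\<close>
  define F' where "F' = inf F (filtercomap \<Phi> (nhds \<phi>))"
  show ?thesis
  proof (rule that)
    \<comment> \<open>Were \<open>F'\<close> trivial, the image of \<open>F\<close> would eventually
      avoid a neighbourhood of \<open>\<phi>\<close>, which would then be no cluster point.\<close>
    have "filtermap \<Phi> F' \<noteq> bot"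
    proof
      assume "filtermap \<Phi> F' = bot"
      then have "F' = bot" by (simp add: filtermap_bot_iff)
      then obtain P Q where "eventually P F" "eventually Q (filtercomap \<Phi> (nhds \<phi>))"
        and PQ: "\<And>s. \<not> (P s \<and> Q s)"
        unfolding F'_def trivial_limit_def eventually_inf by auto
      moreover from this(2) obtain R where "eventually R (nhds \<phi>)" "\<And>s. R (\<Phi> s) \<Longrightarrow> Q s"
        by (auto simp: eventually_filtercomap)
      ultimately have "eventually R (nhds \<phi>)" "eventually (\<lambda>h. \<not> R h) (filtermap \<Phi> F)"
        by (auto simp: eventually_filtermap elim!: eventually_mono)
      then have "eventually (\<lambda>_. False) (inf (nhds \<phi>) (filtermap \<Phi> F))"
        unfolding eventually_inf by blast
      with \<phi> show False by (simp add: trivial_limit_def)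
    qed
    then show "F' \<noteq> bot" by auto
    show "F' \<le> F" by (simp add: F'_def)
    fix g :: "'s \<Rightarrow> complex" assume g: "g \<in> ell_inf"
    have "filterlim \<Phi> (nhds \<phi>) F'"
      unfolding F'_def by (rule filterlim_mono[OF filterlim_filtercomap order_refl inf_le2])
    then have "((\<lambda>s. \<Phi> s g) \<longlongrightarrow> \<phi> g) F'"
      by (rule continuous_on_tendsto_compose[OF continuous_on_product_coordinates]) auto
    then show "(g \<longlongrightarrow> \<phi> g) F'"
      using g by (simp add: \<Phi>_def)
  qed
qed

text \<open>Injectivity of the canonical map, read as a statement about annihilators. Applied to
  point masses and their differences it shows that \<open>E\<close> vanishes at no point and
  separates points.\<close>

lemma predual_separates:
  assumes "predual m E" "b \<in> ell1" "\<And>g. g \<in> E \<Longrightarrow> pairing b g = 0"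
  shows "b = (\<lambda>_. 0)"
proof -
  have "inj_on (canonical_map E) ell1"
    using assms(1) by (simp add: predual_def bij_betw_def)
  moreover have "canonical_map E b = canonical_map E (\<lambda>_. 0)"
    using assms(3) by (auto simp: canonical_map_def pairing_def fun_eq_iff)
  moreover have "(\<lambda>_. 0) \<in> ell1" by (simp add: ell1_def)
  ultimately show ?thesis using assms(2) by (auto dest: inj_onD)
qed

lemma predual_nonvanishing:
  assumes "predual m E"
  shows "\<exists>g\<in>E. g s \<noteq> 0"
proof (rule ccontr)
  assume "\<not> ?thesis"
  then have "delta s = (\<lambda>_. 0)"
    by (intro predual_separates[OF assms delta_ell1]) (simp add: pairing_delta)
  from fun_cong[OF this, of s] show False by (simp add: delta_def)
qed

lemma predual_separates_points:
  assumes "predual m E" "s \<noteq> u"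
  shows "\<exists>g\<in>E. g s \<noteq> g u"
proof (rule ccontr)
  assume neg: "\<not> ?thesis"
  \<comment> \<open>The difference of two point masses, written as a sum with a scalar multiple to
    fit the linearity lemmas.\<close>
  define b where "b = (\<lambda>x. delta s x + - 1 * delta u x)"
  have E: "E \<subseteq> ell_inf"
    using assms(1) by (simp add: predual_def closed_sub_bimodule_def)
  have "b = (\<lambda>_. 0)"
  proof (rule predual_separates[OF assms(1)])
    show "b \<in> ell1"
      unfolding b_def by (intro ell1_add ell1_scale delta_ell1)
    fix g assume g: "g \<in> E"
    then have "pairing b g = pairing (delta s) g + pairing (\<lambda>x. - 1 * delta u x) g"
      unfolding b_def using E by (intro pairing_add_left ell1_scale delta_ell1) auto
    also have "pairing (\<lambda>x. - 1 * delta u x) g = - 1 * pairing (delta u) g"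
      by (rule pairing_scale_left)
    finally show "pairing b g = 0"
      using neg g by (simp add: pairing_delta)
  qed
  from fun_cong[OF this, of s] show False
    using assms(2) by (simp add: b_def delta_def)
qed

text \<open>Surjectivity of the canonical map, for functionals whose values outside \<open>E\<close>
  are arbitrary: restriction to \<open>E\<close> makes them extensional.\<close>

lemma predual_represents:
  assumes "predual m E"
    and "\<And>f g. f \<in> E \<Longrightarrow> g \<in> E \<Longrightarrow> \<phi> (\<lambda>s. f s + g s) = \<phi> f + \<phi> g"
    and "\<And>c f. f \<in> E \<Longrightarrow> \<phi> (\<lambda>s. c * f s) = c * \<phi> f"
    and "\<And>f. f \<in> E \<Longrightarrow> cmod (\<phi> f) \<le> C * norm_inf f"
  obtains a where "a \<in> ell1" "\<And>f. f \<in> E \<Longrightarrow> \<phi> f = pairing a f"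
proof -
  have E: "complex_subspace E"
    using assms(1) by (simp add: predual_def closed_sub_bimodule_def)
  have "restrict \<phi> E \<in> dual_space E"
    unfolding dual_space_def using E assms(2-4)
    by (auto simp: complex_subspace_def intro!: exI[of _ C])
  then obtain a where "a \<in> ell1" "restrict \<phi> E = canonical_map E a"
    using assms(1) unfolding predual_def bij_betw_def by blast
  then show ?thesis
    by (intro that[of a]) (auto simp: canonical_map_def fun_eq_iff restrict_def, metis)
qed

text \<open>If a represents a multiplicative functional and f is in E, then
  a f - \<open>\<langle>a, f\<rangle>\<close> a annihilates E, so f takes the value \<open>\<langle>a, f\<rangle>\<close> on the support of a.\<close>

lemma character_is_evaluation:
  assumes "hopf_algebra_predual m E" "a \<in> ell1"
    and mult: "\<And>f g. f \<in> E \<Longrightarrow> g \<in> E \<Longrightarrow> pairing a (\<lambda>s. f s * g s) = pairing a f * pairing a g"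
  shows "a = (\<lambda>_. 0) \<or> (\<exists>r. \<forall>f\<in>E. pairing a f = f r)"
proof (rule disjCI)
  assume "\<not> (\<exists>r. \<forall>f\<in>E. pairing a f = f r)"
  then have no: "\<exists>f\<in>E. pairing a f \<noteq> f r" for r by blast
  have pre: "predual m E"
    using assms(1) by (simp add: hopf_algebra_predual_def)
  then have E: "E \<subseteq> ell_inf"
    by (simp add: predual_def closed_sub_bimodule_def)
  show "a = (\<lambda>_. 0)"
  proof
    fix r
    obtain f where f: "f \<in> E" "pairing a f \<noteq> f r" using no by blast
    define b where "b = (\<lambda>s. a s * f s + - pairing a f * a s)"
    have af: "(\<lambda>s. a s * f s) \<in> ell1"
      using ell1_mult[OF assms(2)] f(1) E by blast
    have "b = (\<lambda>_. 0)"
    proof (rule predual_separates[OF pre])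
      show "b \<in> ell1"
        unfolding b_def by (intro ell1_add ell1_scale af assms(2))
      fix g assume g: "g \<in> E"
      then have "pairing b g = pairing (\<lambda>s. a s * f s) g + pairing (\<lambda>s. - pairing a f * a s) g"
        unfolding b_def using E by (intro pairing_add_left ell1_scale af assms(2)) auto
      also have "pairing (\<lambda>s. - pairing a f * a s) g = - pairing a f * pairing a g"
        by (rule pairing_scale_left)
      also have "pairing (\<lambda>s. a s * f s) g = pairing a (\<lambda>s. f s * g s)"
        by (simp add: pairing_def mult.assoc)
      finally show "pairing b g = 0"
        using mult[OF f(1) g] by simp
    qed
    from fun_cong[OF this, of r] have "a r * (f r - pairing a f) = 0"
      by (simp add: b_def algebra_simps)
    then show "a r = 0" using f(2) by auto
  qed
qed

text \<open>Limits along a proper filter respect sums, scalars and products and are bounded by the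
  sup norm, so \<open>\<phi>\<close> is a multiplicative functional on \<open>E\<close> represented
  in \<open>ell1\<close>. The zero alternative is the case \<open>a = 0\<close>.\<close>

lemma filter_limit_is_evaluation:
  assumes "hopf_algebra_predual m E" "F \<noteq> bot" "\<And>f. f \<in> E \<Longrightarrow> (f \<longlongrightarrow> \<phi> f) F"
  shows "(\<forall>f\<in>E. \<phi> f = 0) \<or> (\<exists>r. \<forall>f\<in>E. \<phi> f = f r)"
proof -
  have pre: "predual m E" and alg: "\<And>f g. f \<in> E \<Longrightarrow> g \<in> E \<Longrightarrow> (\<lambda>s. f s * g s) \<in> E"
    using assms(1) by (auto simp: hopf_algebra_predual_def)
  have E: "E \<subseteq> ell_inf" "complex_subspace E"
    using pre by (auto simp: predual_def closed_sub_bimodule_def)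
  obtain a where a: "a \<in> ell1" "\<And>f. f \<in> E \<Longrightarrow> \<phi> f = pairing a f"
  proof (rule predual_represents[OF pre, of \<phi> 1])
    fix f g assume f: "f \<in> E" and g: "g \<in> E"
    have "(\<lambda>s. f s + g s) \<in> E" using E(2) f g by (simp add: complex_subspace_def)
    then show "\<phi> (\<lambda>s. f s + g s) = \<phi> f + \<phi> g"
      by (intro tendsto_unique[OF assms(2) assms(3)] tendsto_add assms(3) f g)
  next
    fix c f assume f: "f \<in> E"
    have "(\<lambda>s. c * f s) \<in> E" using E(2) f by (simp add: complex_subspace_def)
    then show "\<phi> (\<lambda>s. c * f s) = c * \<phi> f"
      by (intro tendsto_unique[OF assms(2) assms(3)] tendsto_mult_left assms(3) f)
    have "\<forall>s. cmod (f s) \<le> norm_inf f"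
      using norm_inf_upper[OF subsetD[OF E(1) f]] by simp
    then show "cmod (\<phi> f) \<le> 1 * norm_inf f"
      using tendsto_upperbound[OF tendsto_norm[OF assms(3)[OF f]] _ assms(2)] by simp
  qed (use that in blast)
  have "pairing a (\<lambda>s. f s * g s) = pairing a f * pairing a g" if f: "f \<in> E" and g: "g \<in> E" for f g
  proof -
    have "\<phi> (\<lambda>s. f s * g s) = \<phi> f * \<phi> g"
      by (rule tendsto_unique[OF assms(2) assms(3)[OF alg[OF f g]]])
        (intro tendsto_mult assms(3) f g)
    then show ?thesis unfolding a(2)[OF f] a(2)[OF g] a(2)[OF alg[OF f g]] .
  qed
  then have "a = (\<lambda>_. 0) \<or> (\<exists>r. \<forall>f\<in>E. pairing a f = f r)"
    by (rule character_is_evaluation[OF assms(1) a(1)])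
  then show ?thesis
    using a(2) by (auto simp: pairing_def)
qed

section \<open>Uniqueness\<close>

text \<open>The demands on \<open>T\<close> serve different ends: the cofinite union makes a filter
  at infinity meet one \<open>range (m t)\<close>, and the omission of \<open>s\<close> makes
  \<open>s\<close> and \<open>m t r\<close> distinct points for \<open>E\<close> to
  separate.\<close>

lemma hopf_algebra_predual_subset_c0:
  assumes hopf: "hopf_algebra_predual m E"
    and cover: "\<And>s. \<exists>T. finite T \<and> finite (- (\<Union>t\<in>T. range (m t))) \<and> s \<notin> (\<Union>t\<in>T. range (m t))"
  shows "E \<subseteq> c0"
proof
  fix f assume f: "f \<in> E"
  have pre: "predual m E"
    using hopf by (simp add: hopf_algebra_predual_def)
  have E: "E \<subseteq> ell_inf" and actall: "\<forall>a\<in>ell1. \<forall>g\<in>E. ract m g a \<in> E"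
    using pre by (auto simp: predual_def closed_sub_bimodule_def)
  have act: "ract m g (delta t) \<in> E" if "g \<in> E" for g t
    by (rule bspec[OF bspec[OF actall delta_ell1] that])
  show "f \<in> c0"
  proof (rule ccontr)
    assume "f \<notin> c0"
    then obtain e where e: "0 < e" "infinite {s. e \<le> cmod (f s)}"
      by (auto simp: c0_iff)
    \<comment> \<open>Points going to infinity while \<open>f\<close> stays at least
      \<open>e\<close> in modulus, so that the limit of \<open>f\<close> is nonzero.\<close>
    define F where "F = inf cofinite (principal {s. e \<le> cmod (f s)})"
    have "F \<noteq> bot"
      using e(2) by (auto simp: F_def trivial_limit_def eventually_inf_principal eventually_cofinite)
    then obtain F' \<phi> where F': "F' \<noteq> bot" "F' \<le> F" and \<phi>: "\<And>g. g \<in> ell_inf \<Longrightarrow> (g \<longlongrightarrow> \<phi> g) F'"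
      by (rule limit_along_subfilter) (rule that)
    have \<phi>E: "(g \<longlongrightarrow> \<phi> g) F'" if "g \<in> E" for g
      using \<phi> that E by blast
    have "eventually (\<lambda>s. e \<le> cmod (f s)) F"
      by (simp add: F_def eventually_inf_principal)
    then have "eventually (\<lambda>s. e \<le> cmod (f s)) F'"
      using F'(2) filter_leD by blast
    then have "e \<le> cmod (\<phi> f)"
      by (rule tendsto_lowerbound[OF tendsto_norm[OF \<phi>E[OF f]] _ F'(1)])
    then have "\<phi> f \<noteq> 0" using e(1) by auto
    then obtain s where s: "\<And>g. g \<in> E \<Longrightarrow> \<phi> g = g s"
      using filter_limit_is_evaluation[OF hopf F'(1) \<phi>E] f by blast
    obtain T where T: "finite T" "finite (- (\<Union>t\<in>T. range (m t)))" "s \<notin> (\<Union>t\<in>T. range (m t))"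
      using cover by blast
    have "{x. \<not> (\<exists>t\<in>T. x \<in> range (m t))} = - (\<Union>t\<in>T. range (m t))"
      by auto
    then have "eventually (\<lambda>x. \<exists>t\<in>T. x \<in> range (m t)) cofinite"
      unfolding eventually_cofinite using T(2) by simp
    moreover have "F' \<le> cofinite"
      using F'(2) by (simp add: F_def)
    ultimately have "eventually (\<lambda>x. \<exists>t\<in>T. x \<in> range (m t)) F'"
      using filter_leD by blast
    \<comment> \<open>Unlike \<open>eventually\<close>, \<open>frequently\<close> distributes over a
      finite disjunction, which singles out one \<open>t\<close>.\<close>
    then have "frequently (\<lambda>x. \<exists>t\<in>T. x \<in> range (m t)) F'"
      using F'(1) eventually_frequently by blast
    then have "\<exists>t\<in>T. frequently (\<lambda>x. x \<in> range (m t)) F'"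
      by (rule frequently_bex_finite[OF T(1)])
    then obtain t where t: "t \<in> T" "frequently (\<lambda>x. x \<in> range (m t)) F'"
      by blast
    have "filtercomap (m t) F' \<noteq> bot"
    proof (rule filtercomap_neq_bot)
      fix P assume "eventually P F'"
      with t(2) have "frequently (\<lambda>x. P x \<and> x \<in> range (m t)) F'"
        by (rule frequently_eventually_conj)
      then show "\<exists>x. P (m t x)"
        using frequently_ex by blast
    qed
    then obtain V \<psi> where V: "V \<noteq> bot" "V \<le> filtercomap (m t) F'"
      and \<psi>: "\<And>g. g \<in> ell_inf \<Longrightarrow> (g \<longlongrightarrow> \<psi> g) V"
      by (rule limit_along_subfilter) (rule that)
    have \<psi>E: "(g \<longlongrightarrow> \<psi> g) V" if "g \<in> E" for g
      using \<psi> that E by blast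
    \<comment> \<open>The right action of \<open>delta t\<close> is composition with
      \<open>m t\<close>, so it keeps \<open>g\<close> in \<open>E\<close>. As \<open>V\<close>
      refines the pullback of \<open>F'\<close>, the translate tends along \<open>V\<close> to the
      limit of \<open>g\<close> along \<open>F'\<close>.\<close>
    have shift: "(\<lambda>x. g (m t x)) \<in> E" "\<psi> (\<lambda>x. g (m t x)) = g s" if g: "g \<in> E" for g
    proof -
      show gE: "(\<lambda>x. g (m t x)) \<in> E"
        using act[OF g, of t] by (simp add: ract_delta[abs_def])
      have "((\<lambda>x. g (m t x)) \<longlongrightarrow> \<phi> g) V"
        by (rule filterlim_mono[OF filterlim_filtercomapI[OF \<phi>E[OF g]] order_refl V(2)])
      then show "\<psi> (\<lambda>x. g (m t x)) = g s"
        using tendsto_unique[OF V(1) \<psi>E[OF gE]] s[OF g] by simp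
    qed
    have "(\<forall>g\<in>E. \<psi> g = 0) \<or> (\<exists>r. \<forall>g\<in>E. \<psi> g = g r)"
      by (rule filter_limit_is_evaluation[OF hopf V(1) \<psi>E])
    then show False
    proof (elim disjE exE)
      assume "\<forall>g\<in>E. \<psi> g = 0"
      then have "g s = 0" if "g \<in> E" for g
        using shift[OF that] by force
      then show False using predual_nonvanishing[OF pre] by blast
    next
      fix r assume "\<forall>g\<in>E. \<psi> g = g r"
      then have "g s = g (m t r)" if "g \<in> E" for g
        using shift[OF that] by force
      moreover have "s \<noteq> m t r" using T(3) t(1) by blast
      ultimately show False using predual_separates_points[OF pre] by blast
    qed
  qed
qed

text \<open>Taking f in E with f s = 1 and h in E with h s = 1 that vanishes at the finitely many
  other points where \<open>\<bar>f\<bar> \<ge> 1/2\<close>, the functions \<open>f\<^sup>n h\<close> converge uniformly to \<open>delta s\<close>.\<close>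

lemma delta_mem_hopf_algebra_predual:
  assumes hopf: "hopf_algebra_predual m E" and "E \<subseteq> c0"
  shows "delta s \<in> E"
proof -
  have pre: "predual m E" and alg: "\<And>f g. f \<in> E \<Longrightarrow> g \<in> E \<Longrightarrow> (\<lambda>s. f s * g s) \<in> E"
    using hopf by (auto simp: hopf_algebra_predual_def)
  have E: "E \<subseteq> ell_inf" and closed: "norm_closed E"
    and add: "\<And>f g. f \<in> E \<Longrightarrow> g \<in> E \<Longrightarrow> (\<lambda>s. f s + g s) \<in> E"
    and scale: "\<And>c f. f \<in> E \<Longrightarrow> (\<lambda>s. c * f s) \<in> E"
    using pre by (auto simp: predual_def closed_sub_bimodule_def complex_subspace_def)
  \<comment> \<open>Rescaling at \<open>s\<close> preserves the zeros already arranged.\<close>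
  have normalize: "\<exists>g\<in>E. g s = 1 \<and> (\<forall>u. f u = 0 \<longrightarrow> g u = 0)" if "f \<in> E" "f s \<noteq> 0" for f
    using scale[OF that(1), of "inverse (f s)"] that(2) by (intro bexI) auto
  obtain f where f: "f \<in> E" "f s = 1"
    using predual_nonvanishing[OF pre] normalize by metis
  have vanish1: "\<exists>h\<in>E. h s = 1 \<and> h u = 0" if su: "s \<noteq> u" for u
  proof -
    obtain g where g: "g \<in> E" "g s \<noteq> g u"
      using predual_separates_points[OF pre su] by blast
    \<comment> \<open>\<open>E\<close> need not contain constants, so \<open>g - g u\<close> is
      multiplied by \<open>f\<close>, which is 1 at \<open>s\<close>.\<close>
    have "(\<lambda>x. g x * f x + - g u * f x) \<in> E"
      by (intro add scale alg g f)
    from normalize[OF this] show ?thesis using g f by auto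
  qed
  have vanish: "\<exists>h\<in>E. h s = 1 \<and> (\<forall>u\<in>F. h u = 0)" if "finite F" "s \<notin> F" for F
    using that
  proof (induction F)
    case empty
    then show ?case using f by auto
  next
    case (insert u F)
    then obtain g h where "g \<in> E" "g s = 1" "g u = 0" "h \<in> E" "h s = 1" "\<forall>u\<in>F. h u = 0"
      using vanish1[of u] by auto
    then show ?case
      using alg[of g h] by (intro bexI[of _ "\<lambda>x. g x * h x"]) auto
  qed
  define F where "F = {u. 1 / 2 \<le> cmod (f u)} - {s}"
  have "f \<in> c0" using f(1) assms(2) by blast
  then have "finite {u. 1 / 2 \<le> cmod (f u)}"
    unfolding c0_iff by (metis half_gt_zero zero_less_one)
  then have "finite F" by (simp add: F_def)
  then obtain h where h: "h \<in> E" "h s = 1" "\<And>u. u \<in> F \<Longrightarrow> h u = 0"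
    using vanish[of F] by (auto simp: F_def)
  \<comment> \<open>The factor \<open>h\<close> starts the induction: the power with exponent 0 is a
    constant, which need not lie in \<open>E\<close>.\<close>
  have fh: "(\<lambda>u. f u ^ n * h u) \<in> E" for n
  proof (induction n)
    case (Suc n)
    then show ?case using alg[OF f(1) Suc] by (simp add: mult.assoc)
  qed (use h in simp)
  have "\<exists>g\<in>E. norm_inf (\<lambda>u. delta s u - g u) < e" if e: "0 < e" for e
  proof -
    have B: "0 \<le> norm_inf h" "\<And>u. cmod (h u) \<le> norm_inf h"
      by (rule norm_inf_nonneg norm_inf_upper, rule subsetD[OF E h(1)])+
    have "(\<lambda>n. (1 / 2) ^ n * norm_inf h) \<longlonglongrightarrow> 0"
      by (intro tendsto_mult_left_zero LIMSEQ_power_zero) simp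
    then have "\<forall>\<^sub>F n in sequentially. (1 / 2) ^ n * norm_inf h < e"
      by (rule order_tendstoD(2)) (rule e)
    then obtain n where n: "(1 / 2) ^ n * norm_inf h < e"
      by (auto simp: eventually_sequentially)
    have "cmod (delta s u - f u ^ n * h u) \<le> (1 / 2) ^ n * norm_inf h" for u
    proof (cases "u = s \<or> u \<in> F")
      case True
      then have "delta s u - f u ^ n * h u = 0"
        using f(2) h(2,3) by (auto simp: delta_def F_def)
      then show ?thesis using B(1) by simp
    next
      case False
      then have "cmod (f u) \<le> 1 / 2" "delta s u = 0"
        by (auto simp: F_def delta_def)
      then have "cmod (delta s u - f u ^ n * h u) = cmod (f u) ^ n * cmod (h u)"
        by (simp add: norm_mult norm_power)
      also have "\<dots> \<le> (1 / 2) ^ n * norm_inf h"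
        using \<open>cmod (f u) \<le> 1 / 2\<close> by (intro mult_mono power_mono B) auto
      finally show ?thesis .
    qed
    then have "norm_inf (\<lambda>u. delta s u - f u ^ n * h u) \<le> (1 / 2) ^ n * norm_inf h"
      by (rule norm_inf_least)
    also note n
    finally show ?thesis using fh[of n] by (rule bexI)
  qed
  then show ?thesis
    using closed[unfolded norm_closed_def, rule_format, OF subsetD[OF c0_subset_ell_inf delta_c0]]
    by simp
qed

theorem hopf_algebra_predual_unique:
  assumes "hopf_algebra_predual m E"
    and "\<And>s. \<exists>T. finite T \<and> finite (- (\<Union>t\<in>T. range (m t))) \<and> s \<notin> (\<Union>t\<in>T. range (m t))"
  shows "E = c0"
proof
  show sub: "E \<subseteq> c0"
    by (rule hopf_algebra_predual_subset_c0[OF assms])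
  have "E \<subseteq> ell_inf" "complex_subspace E" "norm_closed E"
    using assms(1) by (auto simp: hopf_algebra_predual_def predual_def closed_sub_bimodule_def)
  then show "c0 \<subseteq> E"
    by (rule c0_subset) (rule delta_mem_hopf_algebra_predual[OF assms(1) sub])
qed

section \<open>The two families of semigroups\<close>

text \<open>Translating by \<open>axis i (Suc (s $ i))\<close> reaches exactly the vectors exceeding
  \<open>s\<close> in coordinate \<open>i\<close>. What all these translates miss is the finite box
  below \<open>s\<close>, with \<open>s\<close> as its corner.\<close>

lemma nat_vec_cover:
  fixes s :: "nat ^ 'k::finite"
  shows "\<exists>T. finite T \<and> finite (- (\<Union>t\<in>T. range ((+) t))) \<and> s \<notin> (\<Union>t\<in>T. range ((+) t))"
proof (intro exI conjI)
  define T where "T = range (\<lambda>i. axis i (Suc (s $ i)))"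
  show "finite T" by (simp add: T_def)
  have "\<exists>i. s $ i < x $ i" if "x \<in> (\<Union>t\<in>T. range ((+) t))" for x
    using that by (auto simp: T_def axis_def less_Suc_eq_le)
  then show "s \<notin> (\<Union>t\<in>T. range ((+) t))" by blast
  have "x \<in> vec_lambda ` (PiE UNIV (\<lambda>i. {..s $ i}))" if x: "x \<notin> (\<Union>t\<in>T. range ((+) t))" for x
  proof -
    have "x $ i \<le> s $ i" for i
    proof (rule ccontr)
      assume "\<not> x $ i \<le> s $ i"
      \<comment> \<open>Truncated subtraction is exact here: only coordinate \<open>i\<close>
        changes, and there \<open>x\<close> is large enough.\<close>
      then have "x = axis i (Suc (s $ i)) + (x - axis i (Suc (s $ i)))"
        by (auto simp: vec_eq_iff axis_def)
      then have "x \<in> (\<Union>t\<in>T. range ((+) t))"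
        unfolding T_def by blast
      with x show False by blast
    qed
    then show ?thesis
      by (intro image_eqI[of _ _ "vec_nth x"]) auto
  qed
  then have "- (\<Union>t\<in>T. range ((+) t)) \<subseteq> vec_lambda ` (PiE UNIV (\<lambda>i. {..s $ i}))"
    by blast
  then show "finite (- (\<Union>t\<in>T. range ((+) t)))"
    by (rule finite_subset) (intro finite_imageI finite_PiE; simp)
qed

section \<open>Words and prefixes in the free semigroup\<close>

lemma Rep_free_semigroup_times: "Rep_free_semigroup (s * t) = Rep_free_semigroup s @ Rep_free_semigroup t"
  by (rule times_free_semigroup.rep_eq)

lemma Rep_free_semigroup_nonempty: "Rep_free_semigroup x \<noteq> []"
  using Rep_free_semigroup by blast

lemma finite_free_semigroup_length_le:
  "finite {x :: 'k::finite free_semigroup. length (Rep_free_semigroup x) \<le> n}"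
proof (rule finite_imageD)
  show "finite (Rep_free_semigroup ` {x :: 'k free_semigroup. length (Rep_free_semigroup x) \<le> n})"
    by (rule finite_subset[OF _ finite_lists_length_le[OF finite[of "UNIV :: 'k set"], of n]]) auto
  show "inj_on Rep_free_semigroup {x :: 'k free_semigroup. length (Rep_free_semigroup x) \<le> n}"
    by (simp add: inj_on_def Rep_free_semigroup_inject)
qed

text \<open>Take for \<open>T\<close> all words as long as \<open>s\<close>. A product
  \<open>t * r\<close> is strictly longer because \<open>r\<close> is nonempty, so it is never
  \<open>s\<close>; conversely every longer word splits off a prefix in \<open>T\<close>.\<close>

lemma free_semigroup_cover:
  fixes s :: "'k::finite free_semigroup"
  shows "\<exists>T. finite T \<and> finite (- (\<Union>t\<in>T. range ((*) t))) \<and> s \<notin> (\<Union>t\<in>T. range ((*) t))"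
proof (intro exI conjI)
  define n where "n = length (Rep_free_semigroup s)"
  define T where "T = {t :: 'k free_semigroup. length (Rep_free_semigroup t) = n}"
  \<comment> \<open>Positivity makes the prefix of length \<open>n\<close> a nonempty word, hence an
    element of the semigroup.\<close>
  have "0 < n" using Rep_free_semigroup[of s] by (simp add: n_def)
  show "finite T"
    unfolding T_def by (rule finite_subset[OF _ finite_free_semigroup_length_le[of n]]) auto
  have "n < length (Rep_free_semigroup x)" if "x \<in> (\<Union>t\<in>T. range ((*) t))" for x
    using that by (auto simp: T_def Rep_free_semigroup_times Rep_free_semigroup_nonempty)
  then show "s \<notin> (\<Union>t\<in>T. range ((*) t))"
    unfolding n_def by blast
  have long: "x \<in> (\<Union>t\<in>T. range ((*) t))" if x: "n < length (Rep_free_semigroup x)" for x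
  proof -
    define t r where "t = Abs_free_semigroup (take n (Rep_free_semigroup x))"
      and "r = Abs_free_semigroup (drop n (Rep_free_semigroup x))"
    have t: "Rep_free_semigroup t = take n (Rep_free_semigroup x)"
      unfolding t_def using x \<open>0 < n\<close> by (intro Abs_free_semigroup_inverse) auto
    have r: "Rep_free_semigroup r = drop n (Rep_free_semigroup x)"
      unfolding r_def using x by (intro Abs_free_semigroup_inverse) auto
    have "x = t * r"
      by (simp add: Rep_free_semigroup_inject[symmetric] Rep_free_semigroup_times t r)
    moreover have "t \<in> T" using x by (simp add: T_def t)
    ultimately show ?thesis by blast
  qed
  have "- (\<Union>t\<in>T. range ((*) t)) \<subseteq> {x. length (Rep_free_semigroup x) \<le> n}"
    by (intro subsetI CollectI leI notI) (drule ComplD, erule notE, erule long)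
  then show "finite (- (\<Union>t\<in>T. range ((*) t)))"
    by (rule finite_subset) (rule finite_free_semigroup_length_le)
qed

lemma inj_free_semigroup_times:
  "inj ((*) (t :: 'k free_semigroup))" "inj (\<lambda>s :: 'k free_semigroup. s * t)"
  by (auto intro!: injI simp: Rep_free_semigroup_inject[symmetric] Rep_free_semigroup_times)

text \<open>The number k is the cardinality of the finite type \<open>'k\<close>; it is at least 1
  because types are nonempty.\<close>

theorem corollary2p9:
  shows "(hopf_algebra_predual ((+) :: nat ^ 'k::finite \<Rightarrow> nat ^ 'k \<Rightarrow> nat ^ 'k) c0
           \<and> (\<forall>E. hopf_algebra_predual ((+) :: nat ^ 'k \<Rightarrow> nat ^ 'k \<Rightarrow> nat ^ 'k) E
                  \<longrightarrow> E = c0))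
       \<and> (hopf_algebra_predual
             ((*) :: 'k free_semigroup \<Rightarrow> 'k free_semigroup \<Rightarrow> 'k free_semigroup) c0
           \<and> (\<forall>E. hopf_algebra_predual
                   ((*) :: 'k free_semigroup \<Rightarrow> 'k free_semigroup \<Rightarrow> 'k free_semigroup) E
                  \<longrightarrow> E = c0))"
proof (intro conjI allI impI)
  have "inj ((+) t)" "inj (\<lambda>s. s + t)" for t :: "nat ^ 'k"
    by (auto intro!: injI simp: vec_eq_iff)
  then show "hopf_algebra_predual ((+) :: nat ^ 'k \<Rightarrow> nat ^ 'k \<Rightarrow> nat ^ 'k) c0"
    by (rule hopf_algebra_predual_c0)
  show "hopf_algebra_predual
      ((*) :: 'k free_semigroup \<Rightarrow> 'k free_semigroup \<Rightarrow> 'k free_semigroup) c0"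
    by (intro hopf_algebra_predual_c0 inj_free_semigroup_times)
  show "E = c0" if "hopf_algebra_predual ((+) :: nat ^ 'k \<Rightarrow> nat ^ 'k \<Rightarrow> nat ^ 'k) E" for E
    by (rule hopf_algebra_predual_unique[OF that nat_vec_cover])
  show "E = c0" if "hopf_algebra_predual
      ((*) :: 'k free_semigroup \<Rightarrow> 'k free_semigroup \<Rightarrow> 'k free_semigroup) E" for E
    by (rule hopf_algebra_predual_unique[OF that free_semigroup_cover])
qed

end
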